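(* Let $\Omega\subseteq\mathbb{R}^d$ be open and bounded with $C^1$-smooth boundary, let $f\colon\partial\Omega\to\mathbb{R}$, and let $\mathcal{B}=\mathcal{B}_{f,\operatorname{clos}\Omega}$. Assume that $\mathcal{B}$ has a strictly locally concave majorant $W\in C^1(\operatorname{clos}\Omega)$ with $W|_{\partial\Omega}=f$. Suppose that $y\in\partial\Omega$, $x\ne y$, $[x,y)\subseteq\Omega$, and the segment $[x,y]$ is tangent to $\partial\Omega$ at $y$. Then the half-interval $[x,y)$ cannot be a part of any extremal set of $\mathcal{B}$; that is, there are no affine functional $L\colon\mathbb{R}^d\to\mathbb{R}$, affine subspace $l\subseteq\mathbb{R}^d$ and point $x'\in\widetilde{E}(L,l)$ with $[x,y)\subseteq E(x',L,l)$.
   Context: Segments: $[a,b]=\{(1-t)a+tb: 0\le t\le 1\}$, $(a,b)=\{(1-t)a+tb: 0<t<1\}$, $[a,b)=\{(1-t)a+tb:0\le t<1\}$. $\overline{\mathbb{R}}=\mathbb{R}\cup\{-\infty,+\infty\}$. An $\overline{\mathbb{R}}$-valued function $B$ on a convex set is concave if its subgraph $\{(z,t): t\in\mathbb{R},\ t\le B(z)\}$ is convex. A function on a set $D\subseteq\mathbb{R}^d$ is locally concave if its restriction to every segment contained in $D$ is concave; it is strictly locally concave if moreover it is not affine on any nondegenerate segment contained in $D$. $C^1(\operatorname{clos}\Omega)$ denotes functions on $\operatorname{clos}\Omega$ that extend to a $C^1$ function in a neighborhood of $\operatorname{clos}\Omega$. Put $D=\operatorname{clos}\Omega$ and extend $f$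 to $D$ by $-\infty$ off $\partial\Omega$. $\mathcal{B}_{f,D}(x)=\inf\{B(x): B\colon D\to\overline{\mathbb{R}}\text{ locally concave},\ B\ge f\text{ on }D\}$. Assumed finite at every point of $\operatorname{int}D$. Let $\overline{f}(y)=\limsup_{z\in D,\,z\to y}f(z)$ be the upper semicontinuous majorant of $f$ ($z=y$ allowed), $E_0=\{x\in\operatorname{int}D:\mathcal{B}(x)=\overline{f}(x)\}$, $E_{>0}=\operatorname{int}D\setminus E_0$. For a closed convex set $K\subseteq E_{>0}$ with nonempty interior and an affine functional $L$ with $\mathcal{B}|_K\le L|_K$ put $U(K,L)=\{x\in K:\mathcal{B}(x)=L(x)\}$. A convex subset $F$ of a convex set $U$ is a face of $U$ if for all $y,z\in U$ with $(y,z)\cap F\neq\varnothing$ one has $[y,z]\subseteq F$. The pre-extremal set $\widetilde{E}(L,l)$ is the set of points $x\in E_{>0}\cap l$ for which there is a closed convex $K\subseteq E_{>0}$ with nonempty interior such that $x\in\operatorname{int}K$, $\mathcal{B}|_K\le L|_K$, $x\in U(K,L)$, and $l\cap U(K,L)$ is a face of $U(K,L)$ with $\operatorname{aff}(l\cap U(K,L))=l$. For $x\in\widetilde{E}(L,l)$ the extremal set $E(x,L,l)$ is the connected component of $x$ in $\widetilde{E}(L,l)$. *)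

theory Defs
  imports "HOL-Analysis.Analysis"
begin

text \<open>
  The space \<open>\<real>\<^sup>d\<close> is an arbitrary type of class \<^class>\<open>euclidean_space\<close>. Functions on a set \<open>D\<close> are
  total functions of which only the values on \<open>D\<close> are used.
\<close>

definition half_open_segment :: "'a::real_vector \<Rightarrow> 'a \<Rightarrow> 'a set" where
  "half_open_segment a b = {(1 - t) *\<^sub>R a + t *\<^sub>R b | t. 0 \<le> t \<and> t < 1}"

definition affine_functional :: "('a::real_vector \<Rightarrow> real) \<Rightarrow> bool" where
  "affine_functional L \<longleftrightarrow> (\<exists>g c. linear g \<and> (\<forall>z. L z = g z + c))"


text \<open>The subgraph only contains points with real second coordinate.\<close>

definition ereal_concave_on :: "'a::real_vector set \<Rightarrow> ('a \<Rightarrow> ereal) \<Rightarrow> bool" where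
  "ereal_concave_on S B \<longleftrightarrow> convex S \<and> convex {(z, t :: real). z \<in> S \<and> ereal t \<le> B z}"

definition locally_concave_on :: "'a::real_vector set \<Rightarrow> ('a \<Rightarrow> ereal) \<Rightarrow> bool" where
  "locally_concave_on D B \<longleftrightarrow>
     (\<forall>a b. closed_segment a b \<subseteq> D \<longrightarrow> ereal_concave_on (closed_segment a b) B)"

definition affine_on_segment :: "('a::real_vector \<Rightarrow> real) \<Rightarrow> 'a \<Rightarrow> 'a \<Rightarrow> bool" where
  "affine_on_segment W a b \<longleftrightarrow>
     (\<forall>t\<in>{0..1}. W ((1 - t) *\<^sub>R a + t *\<^sub>R b) = (1 - t) * W a + t * W b)"

definition strictly_locally_concave_on :: "'a::real_vector set \<Rightarrow> ('a \<Rightarrow> real) \<Rightarrow> bool" where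
  "strictly_locally_concave_on D W \<longleftrightarrow>
     locally_concave_on D (\<lambda>z. ereal (W z)) \<and>
     (\<forall>a b. a \<noteq> b \<and> closed_segment a b \<subseteq> D \<longrightarrow> \<not> affine_on_segment W a b)"


definition C1_on :: "'a::euclidean_space set \<Rightarrow> ('a \<Rightarrow> real) \<Rightarrow> bool" where
  "C1_on V g \<longleftrightarrow> (\<exists>G. (\<forall>z\<in>V. GDERIV g z :> G z) \<and> continuous_on V G)"

definition C1_up_to_boundary :: "'a::euclidean_space set \<Rightarrow> ('a \<Rightarrow> real) \<Rightarrow> bool" where
  "C1_up_to_boundary D W \<longleftrightarrow>
     (\<exists>V g. open V \<and> D \<subseteq> V \<and> C1_on V g \<and> (\<forall>z\<in>D. g z = W z))"

text \<open>
  The usual notion of a \<open>C\<^sup>1\<close> boundary: near each boundary point, \<open>\<Omega>\<close> is the set where a \<open>C\<^sup>1\<close>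
  function \<open>\<phi>\<close> with nonvanishing gradient is negative, and the boundary is its zero set. In
  particular, \<open>\<Omega>\<close> lies locally on one side of its boundary.
\<close>

definition C1_boundary :: "'a::euclidean_space set \<Rightarrow> bool" where
  "C1_boundary \<Omega> \<longleftrightarrow>
     (\<forall>p\<in>frontier \<Omega>. \<exists>V \<phi>. open V \<and> p \<in> V \<and> C1_on V \<phi> \<and>
        (\<forall>z\<in>V. \<not> GDERIV \<phi> z :> 0) \<and>
        \<Omega> \<inter> V = {z\<in>V. \<phi> z < 0} \<and>
        frontier \<Omega> \<inter> V = {z\<in>V. \<phi> z = 0})"

text \<open>The tangent space of a hypersurface \<open>M\<close> at \<open>p\<close>: velocities of \<open>C\<^sup>1\<close> curves in \<open>M\<close> through \<open>p\<close>.\<close>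

definition tangent_space_at :: "'a::euclidean_space set \<Rightarrow> 'a \<Rightarrow> 'a set" where
  "tangent_space_at M p =
     {v. \<exists>\<gamma> \<epsilon>. \<epsilon> > 0 \<and> \<gamma> C1_differentiable_on {-\<epsilon><..<\<epsilon>} \<and> \<gamma> ` {-\<epsilon><..<\<epsilon>} \<subseteq> M \<and>
        \<gamma> 0 = p \<and> vector_derivative \<gamma> (at 0) = v}"


definition boundary_extension :: "'a::topological_space set \<Rightarrow> ('a \<Rightarrow> real) \<Rightarrow> 'a \<Rightarrow> ereal" where
  "boundary_extension \<Omega> f z = (if z \<in> frontier \<Omega> then ereal (f z) else -\<infinity>)"

definition min_loc_concave :: "'a::euclidean_space set \<Rightarrow> ('a \<Rightarrow> ereal) \<Rightarrow> 'a \<Rightarrow> ereal" where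
  "min_loc_concave D f x = Inf {B x | B. locally_concave_on D B \<and> (\<forall>z\<in>D. f z \<le> B z)}"

text \<open>
  The filter below, unlike \<^term>\<open>at y within D\<close>, does not exclude the point \<open>y\<close> itself.
\<close>

definition usc_majorant :: "'a::euclidean_space set \<Rightarrow> ('a \<Rightarrow> ereal) \<Rightarrow> 'a \<Rightarrow> ereal" where
  "usc_majorant D f y = Limsup (inf (nhds y) (principal D)) f"

definition E_zero :: "'a::euclidean_space set \<Rightarrow> ('a \<Rightarrow> ereal) \<Rightarrow> 'a set" where
  "E_zero D f = {x \<in> interior D. min_loc_concave D f x = usc_majorant D f x}"

definition E_pos :: "'a::euclidean_space set \<Rightarrow> ('a \<Rightarrow> ereal) \<Rightarrow> 'a set" where
  "E_pos D f = interior D - E_zero D f"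

definition contact_set ::
    "'a::euclidean_space set \<Rightarrow> ('a \<Rightarrow> ereal) \<Rightarrow> 'a set \<Rightarrow> ('a \<Rightarrow> real) \<Rightarrow> 'a set" where
  "contact_set D f K L = {x \<in> K. min_loc_concave D f x = ereal (L x)}"

definition pre_extremal_set ::
    "'a::euclidean_space set \<Rightarrow> ('a \<Rightarrow> ereal) \<Rightarrow> ('a \<Rightarrow> real) \<Rightarrow> 'a set \<Rightarrow> 'a set" where
  "pre_extremal_set D f L l =
     {x \<in> E_pos D f \<inter> l. \<exists>K. closed K \<and> convex K \<and> K \<subseteq> E_pos D f \<and> interior K \<noteq> {} \<and>
        x \<in> interior K \<and>
        (\<forall>z\<in>K. min_loc_concave D f z \<le> ereal (L z)) \<and>
        x \<in> contact_set D f K L \<and>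
        (l \<inter> contact_set D f K L) face_of contact_set D f K L \<and>
        affine hull (l \<inter> contact_set D f K L) = l}"

definition extremal_set ::
    "'a::euclidean_space set \<Rightarrow> ('a \<Rightarrow> ereal) \<Rightarrow> 'a \<Rightarrow> ('a \<Rightarrow> real) \<Rightarrow> 'a set \<Rightarrow> 'a set" where
  "extremal_set D f x L l = connected_component_set (pre_extremal_set D f L l) x"

end

theory Submission
  imports Defs
begin

text \<open>
  Write \<open>B\<close> for the minimal locally concave function and \<open>v = x - y\<close>, and suppose that \<open>[x, y)\<close> lies in
  an extremal set with affine functional \<open>L\<close>. Then \<open>B = L\<close> on \<open>[x, y)\<close> and \<open>B \<le> L\<close> near each of
  its points. The contradiction comes from comparing the slopes of \<open>W\<close> and \<open>L\<close> at \<open>y\<close>.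

  On \<open>[x, y)\<close> one has \<open>L = B \<le> W\<close>, hence \<open>L y \<le> W y\<close> by continuity. Conversely \<open>W y = f y \<le> B y\<close>,
  and concavity of \<open>B\<close> on \<open>[x, y]\<close> gives \<open>W y \<le> L y\<close>. So \<open>W - L\<close> is a concave, nonnegative,
  non-affine function on \<open>[x, y]\<close> that vanishes at \<open>y\<close>, and therefore its derivative at \<open>y\<close> in the
  direction \<open>v\<close> is strictly positive (\<open>directional_derivative_pos_of_strictly_concave\<close>). As \<open>W\<close> is
  differentiable at \<open>y\<close>, it follows that \<open>W p > L p\<close> at all points \<open>p\<close> close enough to \<open>y\<close> in a
  direction close to \<open>v\<close>.

  Since \<open>v\<close> is tangent to the boundary, boundary points \<open>p\<close> of this kind exist, and moreover they can be
  chosen so that some point \<open>q\<close> of \<open>[x, y)\<close> sees \<open>p\<close> inside the closed domain: tilt the ray from \<open>q\<close>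
  to \<open>y\<close> slightly towards the outside and stop where it first leaves the domain
  (\<open>visible_boundary_points_along_tangent\<close>). At such a \<open>p\<close> one has \<open>B p \<ge> f p = W p > L p\<close>, whereas
  \<open>B q = L q\<close>; concavity along \<open>[q, p]\<close> makes \<open>B\<close> exceed \<open>L\<close> at points arbitrarily close to \<open>q\<close>,
  against \<open>B \<le> L\<close> near \<open>q\<close> (\<open>affine_majorant_near_contact_point_extends\<close>).
\<close>

section \<open>Locally concave functions and affine majorants\<close>

lemma half_open_segment_points:
  fixes x y :: "'a::euclidean_space"
  assumes "0 < t" "t \<le> 1"
  shows "y + t *\<^sub>R (x - y) \<in> half_open_segment x y"
  unfolding half_open_segment_def
  using assms by (auto simp: algebra_simps intro!: exI[of _ "1 - t"])

lemma min_loc_concave_ge: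
  assumes "z \<in> D"
  shows "f z \<le> min_loc_concave D f z"
  unfolding min_loc_concave_def by (rule Inf_greatest) (use assms in auto)

text \<open>
  The subgraph of an infimum is the intersection of the subgraphs. The constant \<open>\<infinity>\<close> is a competitor,
  so this intersection is not over the empty family.
\<close>

lemma locally_concave_min_loc_concave: "locally_concave_on D (min_loc_concave D f)"
  unfolding locally_concave_on_def
proof (intro allI impI)
  fix a b :: 'a assume ab: "closed_segment a b \<subseteq> D"
  let ?F = "{B. locally_concave_on D B \<and> (\<forall>z\<in>D. f z \<le> B z)}"
  have ne: "?F \<noteq> {}"
  proof -
    have "{(z, t :: real). z \<in> closed_segment a b} = closed_segment a b \<times> UNIV" for a b :: 'a
      by auto
    moreover have "convex (closed_segment a b \<times> (UNIV :: real set))" for a b :: 'a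
      by (intro convex_Times) auto
    ultimately have "locally_concave_on D (\<lambda>_. \<infinity>)"
      by (auto simp: locally_concave_on_def ereal_concave_on_def)
    then show ?thesis by (auto intro!: exI[of _ "\<lambda>_. \<infinity>"])
  qed
  have "{(z, t :: real). z \<in> closed_segment a b \<and> ereal t \<le> min_loc_concave D f z}
      = (\<Inter>B\<in>?F. {(z, t :: real). z \<in> closed_segment a b \<and> ereal t \<le> B z})"
    using ne by (auto simp: min_loc_concave_def le_Inf_iff)
  moreover have "convex (\<Inter>B\<in>?F. {(z, t :: real). z \<in> closed_segment a b \<and> ereal t \<le> B z})"
    using ab by (intro convex_INT) (auto simp: locally_concave_on_def ereal_concave_on_def)
  ultimately show "ereal_concave_on (closed_segment a b) (min_loc_concave D f)"
    by (auto simp: ereal_concave_on_def)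
qed

lemma locally_concave_onD:
  assumes "locally_concave_on D B" "closed_segment a b \<subseteq> D"
    and "ereal s \<le> B a" "ereal t \<le> B b" "0 \<le> u" "u \<le> 1"
  shows "ereal ((1 - u) * s + u * t) \<le> B ((1 - u) *\<^sub>R a + u *\<^sub>R b)"
proof -
  have "convex {(z, t :: real). z \<in> closed_segment a b \<and> ereal t \<le> B z}" (is "convex ?G")
    using assms by (auto simp: locally_concave_on_def ereal_concave_on_def)
  then have "(1 - u) *\<^sub>R (a, s) + u *\<^sub>R (b, t) \<in> ?G"
    using assms by (intro convexD) auto
  then show ?thesis by auto
qed

lemma affine_functional_combine:
  assumes "affine_functional L"
  shows "L ((1 - u) *\<^sub>R a + u *\<^sub>R b) = (1 - u) * L a + u * L b"
proof -
  obtain l c where l: "linear l" "\<And>z. L z = l z + c"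
    using assms by (auto simp: affine_functional_def)
  have "l ((1 - u) *\<^sub>R a + u *\<^sub>R b) = (1 - u) * l a + u * l b"
    by (simp only: linear_add[OF l(1)] linear_scale[OF l(1)] real_scaleR_def)
  then show ?thesis by (simp add: l(2) algebra_simps)
qed

text \<open>
  The difference \<open>B - L\<close> is concave on the segment, zero at \<open>p\<close> and nonpositive near \<open>p\<close>. If it were
  positive at \<open>q\<close>, it would lie above a chord of positive slope and so be positive immediately after \<open>p\<close>.
\<close>

lemma affine_majorant_near_contact_point_extends:
  fixes p q :: "'a::euclidean_space"
  assumes B: "locally_concave_on D B" and seg: "closed_segment p q \<subseteq> D"
    and L: "affine_functional L"
    and p: "B p = ereal (L p)" "p \<in> interior K" "\<And>z. z \<in> K \<Longrightarrow> B z \<le> ereal (L z)"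
  shows "B q \<le> ereal (L q)"
proof (rule ccontr)
  assume "\<not> B q \<le> ereal (L q)"
  then obtain t where t: "L q < t" "ereal t \<le> B q"
    by (metis ereal_dense2 less_ereal.simps(1) less_imp_le not_le)
  have "((\<lambda>u. (1 - u) *\<^sub>R p + u *\<^sub>R q) \<longlongrightarrow> (1 - 0) *\<^sub>R p + 0 *\<^sub>R q) (at_right (0::real))"
    by (intro tendsto_intros)
  then have "eventually (\<lambda>u. (1 - u) *\<^sub>R p + u *\<^sub>R q \<in> interior K) (at_right (0::real))"
    using p(2) by (intro topological_tendstoD) auto
  moreover have "eventually (\<lambda>u. u \<in> {0<..<1}) (at_right (0::real))"
    by (rule eventually_at_right_real) simp
  ultimately have "eventually (\<lambda>u. (1 - u) *\<^sub>R p + u *\<^sub>R q \<in> interior K \<and> u \<in> {0<..<1})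
      (at_right (0::real))"
    by (rule eventually_conj)
  then obtain u where u: "(1 - u) *\<^sub>R p + u *\<^sub>R q \<in> interior K" "0 < u" "u < 1"
    using eventually_happens'[OF trivial_limit_at_right_real] by fastforce
  let ?z = "(1 - u) *\<^sub>R p + u *\<^sub>R q"
  have "ereal ((1 - u) * L p + u * t) \<le> B ?z"
    using u p(1) t by (intro locally_concave_onD[OF B seg]) auto
  also have "\<dots> \<le> ereal (L ?z)"
    using u p(3) interior_subset by blast
  finally have "u * t \<le> u * L q"
    by (simp add: affine_functional_combine[OF L])
  then show False using t u by simp
qed

section \<open>Boundary points near a tangent segment\<close>

lemma GDERIV_linear_approx:
  assumes "GDERIV f y :> D" "0 < e"
  obtains d where "0 < d"
    "\<And>z. norm (z - y) < d \<Longrightarrow> \<bar>f z - f y - inner D (z - y)\<bar> \<le> e * norm (z - y)"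
  using assms unfolding gderiv_def has_derivative_at_alt
  by (metis inner_commute real_norm_def)

text \<open>A defining function vanishes along every curve in the hypersurface; differentiate this along the curve.\<close>

lemma gradient_orthogonal_tangent_space:
  fixes y :: "'a::euclidean_space"
  assumes "open V" "y \<in> V" and N: "GDERIV \<phi> y :> N"
    and zero: "\<And>z. z \<in> M \<inter> V \<Longrightarrow> \<phi> z = (0::real)"
    and v: "v \<in> tangent_space_at M y"
  shows "inner N v = 0"
proof -
  obtain \<gamma> e where g: "e > 0" "\<gamma> C1_differentiable_on {-e<..<e}" "\<gamma> ` {-e<..<e} \<subseteq> M"
      "\<gamma> 0 = y" "vector_derivative \<gamma> (at (0::real)) = v"
    using v by (auto simp: tangent_space_at_def)
  have "\<gamma> differentiable at 0"
    using g(1,2) by (auto simp: C1_differentiable_on_eq)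
  then have gv: "(\<gamma> has_vector_derivative v) (at 0)"
    using g(5) vector_derivative_works by blast
  then have "((\<lambda>t. \<phi> (\<gamma> t)) has_derivative (\<lambda>t. inner (t *\<^sub>R v) N)) (at 0)"
    using has_derivative_compose[of \<gamma> "\<lambda>t. t *\<^sub>R v" 0 UNIV \<phi> "\<lambda>h. inner h N"] N g(4)
    by (auto simp: has_vector_derivative_def gderiv_def)
  moreover have "eventually (\<lambda>t. \<phi> (\<gamma> t) = 0) (nhds 0)"
  proof -
    have "isCont \<gamma> 0" using gv has_vector_derivative_continuous by blast
    then have "eventually (\<lambda>t. \<gamma> t \<in> V) (nhds 0)"
      using assms(1,2) g(4) by (metis isCont_def tendsto_at_iff_tendsto_nhds topological_tendstoD)
    moreover have "eventually (\<lambda>t. t \<in> {-e<..<e}) (nhds 0)"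
      using g(1) by (intro eventually_nhds_in_open) auto
    ultimately show ?thesis by eventually_elim (use g(3) zero in blast)
  qed
  then have "((\<lambda>t. \<phi> (\<gamma> t)) has_derivative (\<lambda>_. 0)) (at 0)"
    by (intro has_derivative_transform_eventually[OF has_derivative_const[of 0]])
       (auto simp: eventually_at_filter elim: eventually_mono dest: eventually_nhds_x_imp_x)
  ultimately have "(\<lambda>t. inner (t *\<^sub>R v) N) = (\<lambda>_. 0)"
    by (rule has_derivative_unique)
  from fun_cong[OF this, of 1] show ?thesis by (simp add: inner_commute)
qed

text \<open>
  Let \<open>N\<close> be the gradient at \<open>y\<close> of the defining function \<open>\<phi>\<close>, an outer normal. For small \<open>e > 0\<close> the
  point \<open>y + e N\<close> is outside the closed domain, so the segment from \<open>y + r v\<close> to it leaves the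
  domain for the first time at some \<open>p = y + a v + b N\<close> with \<open>a, b > 0\<close>. As \<open>\<phi> p = 0\<close> and
  \<open>N\<close> is orthogonal to \<open>v\<close>, the linear approximation of \<open>\<phi>\<close> at \<open>y\<close> bounds \<open>b |N|\<^sup>2\<close> by a small multiple of
  \<open>a |v| + b |N|\<close>. Hence \<open>b\<close> is small compared with \<open>a\<close>, and the perturbation \<open>w = (b / a) N\<close> of the
  direction \<open>v\<close> is as small as desired.

  No limit in \<open>e\<close> is taken: once both endpoints of the segment lie in a ball about \<open>y\<close> in which the
  approximation is good enough, so does \<open>p\<close>.
\<close>

lemma visible_boundary_points_along_tangent:
  fixes y v :: "'a::euclidean_space"
  assumes \<Omega>: "open \<Omega>" "bounded \<Omega>" "C1_boundary \<Omega>"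
    and y: "y \<in> frontier \<Omega>" and v: "v \<in> tangent_space_at (frontier \<Omega>) y"
    and seg: "\<And>t. 0 < t \<Longrightarrow> t \<le> 1 \<Longrightarrow> y + t *\<^sub>R v \<in> \<Omega>"
    and \<eta>: "0 < \<eta>"
  obtains r a w where "0 < r" "r \<le> 1" "0 < a" "a < \<eta>" "norm w \<le> \<eta>"
    "y + a *\<^sub>R (v + w) \<in> frontier \<Omega>"
    "closed_segment (y + r *\<^sub>R v) (y + a *\<^sub>R (v + w)) \<subseteq> closure \<Omega>"
proof -
  obtain V \<phi> where V: "open V" "y \<in> V" "C1_on V \<phi>" "\<And>z. z \<in> V \<Longrightarrow> \<not> GDERIV \<phi> z :> 0"
    and inside: "\<Omega> \<inter> V = {z\<in>V. \<phi> z < 0}" and bdry: "frontier \<Omega> \<inter> V = {z\<in>V. \<phi> z = 0}"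
    using \<Omega>(3) y unfolding C1_boundary_def by (elim ballE) auto
  obtain N where N: "GDERIV \<phi> y :> N" using V by (auto simp: C1_on_def)
  then have N0: "N \<noteq> 0" using V by auto
  have Nv: "inner N v = 0"
    by (rule gradient_orthogonal_tangent_space[OF V(1,2) N _ v]) (use bdry in auto)
  have \<phi>y: "\<phi> y = 0" using y V(2) bdry by auto
  \<comment> \<open>With relative error at most \<open>|N| / 2\<close> the term \<open>b |N|\<close> can be absorbed on the left; the other
      bound turns the remaining estimate \<open>b |N|\<^sup>2 \<le> 2 k a |v|\<close> into \<open>|w| \<le> \<eta>\<close>.\<close>
  define k where "k = min (norm N / 2) (\<eta> * norm N / (2 * (norm v + 1)))"
  have k: "0 < k" "k \<le> norm N / 2" "2 * k * (norm v + 1) \<le> \<eta> * norm N"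
  proof -
    have v1: "0 < norm v + 1" by (simp add: add_nonneg_pos)
    then show "0 < k" using N0 \<eta> by (auto simp: k_def)
    show "k \<le> norm N / 2" unfolding k_def by (rule min.cobounded1)
    have "k \<le> \<eta> * norm N / (2 * (norm v + 1))" unfolding k_def by (rule min.cobounded2)
    then show "2 * k * (norm v + 1) \<le> \<eta> * norm N" using v1 by (simp add: field_simps)
  qed
  obtain d1 where d1: "0 < d1"
    "\<And>z. norm (z - y) < d1 \<Longrightarrow> \<bar>\<phi> z - \<phi> y - inner N (z - y)\<bar> \<le> k * norm (z - y)"
    using GDERIV_linear_approx[OF N k(1)] by blast
  obtain d2 where d2: "0 < d2" "ball y d2 \<subseteq> V" using V by (meson open_contains_ball)
  define d where "d = min d1 d2"
  have d: "0 < d" "ball y d \<subseteq> V"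
    "\<And>z. z \<in> ball y d \<Longrightarrow> \<bar>\<phi> z - inner N (z - y)\<bar> \<le> k * norm (z - y)"
    using d1 d2 \<phi>y by (auto simp: d_def dist_norm norm_minus_commute)
  define r where "r = Min {1, \<eta>, d / (2 * (norm v + 1))}"
  have r: "0 < r" "r \<le> 1" "r \<le> \<eta>" "r * norm v < d"
  proof -
    have v1: "0 < norm v + 1" by (simp add: add_nonneg_pos)
    then show r0: "0 < r" using \<eta> d(1) by (auto simp: r_def)
    show "r \<le> 1" "r \<le> \<eta>" by (auto simp: r_def)
    have "r \<le> d / (2 * (norm v + 1))" by (simp add: r_def)
    then have "2 * r * (norm v + 1) \<le> d" using v1 by (simp add: field_simps)
    moreover have "0 \<le> r * norm v" using r0 by simp
    moreover have "2 * r * (norm v + 1) = 2 * (r * norm v) + 2 * r" by (simp add: algebra_simps)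
    ultimately show "r * norm v < d" using r0 by linarith
  qed
  define e where "e = d / (2 * norm N)"
  have e: "0 < e" "e * norm N < d" using d(1) N0 by (auto simp: e_def)
  let ?q = "y + e *\<^sub>R N"
  have q: "?q \<notin> closure \<Omega>"
  proof -
    have qV: "?q \<in> ball y d" using e by (simp add: dist_norm)
    have "inner N (e *\<^sub>R N) = e * norm N * norm N" by (simp add: dot_square_norm power2_eq_square)
    moreover have "\<bar>\<phi> ?q - inner N (e *\<^sub>R N)\<bar> \<le> k * norm (e *\<^sub>R N)"
      using d(3)[OF qV] by (simp only: add_diff_cancel_left')
    moreover have "k * norm (e *\<^sub>R N) < e * norm N * norm N"
      using k N0 e by (simp add: mult.commute)
    ultimately have "\<phi> ?q > 0" by linarith
    moreover have "?q \<in> V" using qV d(2) by blast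
    ultimately have "?q \<notin> \<Omega>" "?q \<notin> frontier \<Omega>" using inside bdry by (metis (mono_tags, lifting) IntI mem_Collect_eq less_asym less_irrefl)+
    then show ?thesis by (auto simp: closure_Un_frontier)
  qed
  \<comment> \<open>The exit parameter along the segment from \<open>y + r v\<close> to \<open>y + e N\<close> is below 1, which makes \<open>a\<close> positive.\<close>
  let ?l = "e *\<^sub>R N - r *\<^sub>R v" and ?p = "y + r *\<^sub>R v"
  have "inner N ?l = e * (norm N)\<^sup>2" by (simp add: inner_diff_right Nv dot_square_norm)
  then have l0: "?l \<noteq> 0" using e N0 by (metis inner_zero_right mult_eq_0_iff norm_eq_zero order_less_irrefl power_eq_0_iff)
  have "?p \<in> interior \<Omega>" using seg r \<Omega>(1) by (simp add: interior_open)
  then obtain s where s: "0 < s" "?p + s *\<^sub>R ?l \<in> frontier \<Omega>"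
      "\<And>u. 0 \<le> u \<Longrightarrow> u < s \<Longrightarrow> ?p + u *\<^sub>R ?l \<in> interior \<Omega>"
    using ray_to_frontier[OF \<Omega>(2) _ l0] by metis
  have q_eq: "?p + 1 *\<^sub>R ?l = ?q" by simp
  have s1: "s < 1"
  proof (rule ccontr)
    assume "\<not> s < 1"
    then consider "s = 1" | "1 < s" by linarith
    then have "?q \<in> closure \<Omega>"
    proof cases
      case 1
      then show ?thesis using s(2) q_eq by (metis DiffD1 frontier_def)
    next
      case 2
      then have "?p + 1 *\<^sub>R ?l \<in> interior \<Omega>" by (intro s(3)) auto
      then show ?thesis using q_eq interior_subset closure_subset by (metis subsetD)
    qed
    then show False using q by simp
  qed
  define a where "a = (1 - s) * r"
  define b where "b = s * e"
  define w where "w = (b / a) *\<^sub>R N"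
  have a: "0 < a" "a < \<eta>"
  proof -
    show "0 < a" using s1 r by (simp add: a_def)
    have "a < r" using s r by (simp add: a_def algebra_simps)
    then show "a < \<eta>" using r by simp
  qed
  have b: "0 < b" using s e by (simp add: b_def)
  let ?z = "y + a *\<^sub>R (v + w)"
  have zy: "?z - y = a *\<^sub>R v + b *\<^sub>R N" using a by (simp add: w_def algebra_simps)
  have "?p + s *\<^sub>R ?l - y = a *\<^sub>R v + b *\<^sub>R N" by (simp add: a_def b_def algebra_simps)
  then have z_eq: "?p + s *\<^sub>R ?l = ?z"
    using zy by (metis diff_add_cancel)
  have zb: "?z \<in> ball y d"
  proof -
    have "?p + s *\<^sub>R ?l = (1 - s) *\<^sub>R ?p + s *\<^sub>R ?q" by (simp add: algebra_simps)
    then have "?z = (1 - s) *\<^sub>R ?p + s *\<^sub>R ?q" by (simp only: z_eq)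
    moreover have "?p \<in> ball y d" "?q \<in> ball y d" using r e by (auto simp: dist_norm)
    ultimately show ?thesis using s s1 convexD[OF convex_ball, of ?p y d ?q "1 - s" s] by simp
  qed
  have zf: "?z \<in> frontier \<Omega>" using s(2) z_eq by simp
  have "norm w \<le> \<eta>"
  proof -
    have "\<phi> ?z = 0" using zf zb d(2) bdry by blast
    then have "\<bar>inner N (?z - y)\<bar> \<le> k * norm (?z - y)" using d(3)[OF zb] by simp
    moreover have "inner N (?z - y) = b * norm N * norm N"
      unfolding zy by (simp add: inner_add_right Nv dot_square_norm power2_eq_square)
    moreover have "norm (?z - y) \<le> a * norm v + b * norm N"
      unfolding zy using a b by (metis abs_of_pos norm_scaleR norm_triangle_ineq)
    ultimately have "b * norm N * norm N \<le> k * (a * norm v + b * norm N)"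
      using k(1) by (smt (verit) mult_left_mono)
    moreover have "k * (b * norm N) \<le> norm N / 2 * (b * norm N)"
      using k b by (intro mult_right_mono) auto
    ultimately have "b * norm N * norm N \<le> 2 * k * (a * norm v)"
      by (simp add: algebra_simps)
    also have "\<dots> \<le> a * (2 * k * (norm v + 1))"
      using k(1) a by (simp add: algebra_simps)
    also have "\<dots> \<le> a * (\<eta> * norm N)" using k(3) a by simp
    finally have "b * norm N \<le> a * \<eta>" using N0 by simp
    then show ?thesis using a b by (simp add: w_def field_simps)
  qed
  moreover have "closed_segment ?p ?z \<subseteq> closure \<Omega>"
  proof
    fix c assume "c \<in> closed_segment ?p ?z"
    then obtain u where u: "0 \<le> u" "u \<le> 1" "c = (1 - u) *\<^sub>R ?p + u *\<^sub>R ?z"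
      by (auto simp: closed_segment_def)
    then have c: "c = ?p + (u * s) *\<^sub>R ?l" unfolding z_eq[symmetric] by (simp add: algebra_simps)
    show "c \<in> closure \<Omega>"
    proof (cases "u = 1")
      case True
      then show ?thesis using u zf by (simp add: frontier_def)
    next
      case False
      then have "c \<in> interior \<Omega>" unfolding c using u s(1) by (intro s(3)) auto
      then show ?thesis using interior_subset closure_subset by blast
    qed
  qed
  ultimately show thesis using that r a zf by blast
qed

section \<open>The slope of the majorant at the boundary point\<close>

text \<open>
  A nonnegative concave function on \<open>[0, 1]\<close> that vanishes at \<open>0\<close> and is not affine is positive at some
  \<open>m > 0\<close>, and lies above the chord from \<open>0\<close> to \<open>m\<close>, whose slope is positive. The function \<open>g\<close> is an
  extension of \<open>W\<close> for which the gradient at a boundary point makes sense.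
\<close>

lemma directional_derivative_pos_of_strictly_concave:
  fixes y v :: "'a::euclidean_space"
  assumes W: "strictly_locally_concave_on D W" and seg: "closed_segment y (y + v) \<subseteq> D" "v \<noteq> 0"
    and L: "affine_functional L"
    and h0: "W y = L y" and h: "\<And>t. 0 < t \<Longrightarrow> t \<le> 1 \<Longrightarrow> L (y + t *\<^sub>R v) \<le> W (y + t *\<^sub>R v)"
    and H: "GDERIV (\<lambda>z. g z - L z) y :> H" and g: "\<And>z. z \<in> D \<Longrightarrow> g z = W z"
  shows "0 < inner H v"
proof -
  let ?h = "\<lambda>t. W (y + t *\<^sub>R v) - L (y + t *\<^sub>R v)"
  have pt: "(1 - t) *\<^sub>R y + t *\<^sub>R (y + v) = y + t *\<^sub>R v" for t by (simp add: algebra_simps)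
  have Lpt: "L (y + t *\<^sub>R v) = (1 - t) * L y + t * L (y + v)" for t
    using affine_functional_combine[OF L, of t y "y + v"] by (simp only: pt)
  have inD: "y + t *\<^sub>R v \<in> D" if "0 \<le> t" "t \<le> 1" for t
    using that seg(1) pt[of t] unfolding closed_segment_def by fastforce
  have "\<not> affine_on_segment W y (y + v)"
    using W seg by (auto simp: strictly_locally_concave_on_def)
  have "\<exists>m. 0 < m \<and> m \<le> 1 \<and> 0 < ?h m"
  proof (rule ccontr)
    assume none: "\<not> (\<exists>m. 0 < m \<and> m \<le> 1 \<and> 0 < ?h m)"
    have eq: "W (y + t *\<^sub>R v) = L (y + t *\<^sub>R v)" if t: "0 \<le> t" "t \<le> 1" for t
    proof (cases "t = 0")
      case False
      then have "\<not> 0 < ?h t" using none t by auto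
      then show ?thesis using h[of t] False t by simp
    qed (simp add: h0)
    have "W (y + v) = L (y + v)" using eq[of 1] by simp
    then have "affine_on_segment W y (y + v)"
      unfolding affine_on_segment_def pt using Lpt h0 eq by auto
    with \<open>\<not> affine_on_segment W y (y + v)\<close> show False by contradiction
  qed
  then obtain m where m: "0 < m" "m \<le> 1" "?h m > 0" by blast
  have chord: "u * ?h m \<le> ?h (u * m)" if u: "0 \<le> u" "u \<le> 1" for u
  proof -
    have "closed_segment y (y + m *\<^sub>R v) \<subseteq> D"
    proof
      fix z assume "z \<in> closed_segment y (y + m *\<^sub>R v)"
      then obtain u where "0 \<le> u" "u \<le> 1" "z = y + (u * m) *\<^sub>R v"
        by (auto simp: closed_segment_def algebra_simps)
      then show "z \<in> D" using m inD[of "u * m"] by (simp add: mult_le_one)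
    qed
    then have "ereal ((1 - u) * W y + u * W (y + m *\<^sub>R v)) \<le> ereal (W ((1 - u) *\<^sub>R y + u *\<^sub>R (y + m *\<^sub>R v)))"
      using W u by (intro locally_concave_onD[of D "\<lambda>z. ereal (W z)"])
        (auto simp: strictly_locally_concave_on_def)
    moreover have e: "(1 - u) *\<^sub>R y + u *\<^sub>R (y + m *\<^sub>R v) = y + (u * m) *\<^sub>R v"
      by (simp add: algebra_simps)
    moreover have "L (y + (u * m) *\<^sub>R v) = (1 - u) * L y + u * L (y + m *\<^sub>R v)"
      using affine_functional_combine[OF L, of u y "y + m *\<^sub>R v"] by (simp only: e)
    ultimately show ?thesis using h0 by (simp add: algebra_simps)
  qed
  \<comment> \<open>Let \<open>c\<close> be the slope of the chord. An approximation error of at most half this slope leaves a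
      directional derivative of at least \<open>c / 2\<close>.\<close>
  define c where "c = ?h m / m"
  have c: "0 < c" "c * m = ?h m" using m by (auto simp: c_def)
  define e where "e = c / (2 * norm v)"
  have e: "0 < e" "e * norm v = c / 2" using c seg(2) by (auto simp: e_def)
  obtain d where d: "0 < d" "\<And>z. norm (z - y) < d \<Longrightarrow>
      \<bar>(g z - L z) - (g y - L y) - inner H (z - y)\<bar> \<le> e * norm (z - y)"
    using GDERIV_linear_approx[OF H e(1)] by blast
  define u where "u = min 1 (d / (2 * m * norm v))"
  have u: "0 < u" "u \<le> 1" using m d seg(2) by (auto simp: u_def)
  have "u \<le> d / (2 * m * norm v)" by (simp add: u_def)
  then have "2 * (u * m * norm v) \<le> d" using m seg(2) by (simp add: field_simps)
  then have small: "u * m * norm v < d" using d(1) by linarith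
  let ?t = "u * m"
  have t: "0 < ?t" "?t \<le> 1" using u m by (auto simp: mult_le_one)
  have "\<bar>?h ?t - inner H (?t *\<^sub>R v)\<bar> \<le> e * norm (?t *\<^sub>R v)"
    using d(2)[of "y + ?t *\<^sub>R v"] small t u m g[OF inD[of ?t]] g[OF inD[of 0]] h0
    by (simp add: abs_mult)
  moreover have "e * norm (?t *\<^sub>R v) = ?t * (c / 2)"
    using t e(2) u m by (simp add: abs_mult)
  moreover have "?t * c \<le> ?h ?t" using chord[of u] u c(2) by (metis less_imp_le mult.assoc mult.commute)
  ultimately have "?t * (c / 2) \<le> ?t * inner H v" by (simp add: algebra_simps)
  then have "c / 2 \<le> inner H v" using t(1) by (rule mult_left_le_imp_le)
  then show ?thesis using c by simp
qed

lemma affine_functional_GDERIV: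
  fixes L :: "'a::euclidean_space \<Rightarrow> real"
  assumes "affine_functional L"
  obtains G where "\<And>z. GDERIV L z :> G"
proof -
  obtain l c where l: "linear l" "\<And>z. L z = l z + c" using assms by (auto simp: affine_functional_def)
  have "bounded_linear l" using l(1) linear_conv_bounded_linear by blast
  moreover have "l = (\<lambda>h. inner h (adjoint l 1))"
    using adjoint_works[OF l(1)] by (auto simp: inner_real_def)
  moreover have "L = (\<lambda>z. l z + c)" using l(2) by auto
  ultimately have "GDERIV L z :> adjoint l 1" for z
    unfolding gderiv_def by (metis bounded_linear_imp_has_derivative has_derivative_add_const)
  then show thesis using that by blast
qed

section \<open>Tangent segments and extremal sets\<close>

theorem lemma14p1:
  fixes \<Omega> :: "'a::euclidean_space set" and f W :: "'a \<Rightarrow> real" and x y :: 'a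
  assumes "open \<Omega>" and "bounded \<Omega>" and "C1_boundary \<Omega>"
    and "\<And>z. z \<in> interior (closure \<Omega>) \<Longrightarrow>
           \<bar>min_loc_concave (closure \<Omega>) (boundary_extension \<Omega> f) z\<bar> \<noteq> \<infinity>"
    and "strictly_locally_concave_on (closure \<Omega>) W"
    and "\<And>z. z \<in> closure \<Omega> \<Longrightarrow>
           min_loc_concave (closure \<Omega>) (boundary_extension \<Omega> f) z \<le> ereal (W z)"
    and "C1_up_to_boundary (closure \<Omega>) W"
    and "\<And>z. z \<in> frontier \<Omega> \<Longrightarrow> W z = f z"
    and "y \<in> frontier \<Omega>" and "x \<noteq> y" and "half_open_segment x y \<subseteq> \<Omega>"
    and "x - y \<in> tangent_space_at (frontier \<Omega>) y"
  shows "\<not> (\<exists>L l x'. affine_functional L \<and> affine l \<and>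
            x' \<in> pre_extremal_set (closure \<Omega>) (boundary_extension \<Omega> f) L l \<and>
            half_open_segment x y \<subseteq>
              extremal_set (closure \<Omega>) (boundary_extension \<Omega> f) x' L l)"
proof
  let ?D = "closure \<Omega>" and ?f = "boundary_extension \<Omega> f"
  let ?B = "min_loc_concave ?D ?f"
  define v where "v = x - y"
  assume "\<exists>L l x'. affine_functional L \<and> affine l \<and> x' \<in> pre_extremal_set ?D ?f L l \<and>
            half_open_segment x y \<subseteq> extremal_set ?D ?f x' L l"
  then obtain L l x' where L: "affine_functional L"
    and ext: "half_open_segment x y \<subseteq> extremal_set ?D ?f x' L l" by blast
  have pre: "half_open_segment x y \<subseteq> pre_extremal_set ?D ?f L l"
    using ext connected_component_subset unfolding extremal_set_def by blast
  have v0: "v \<noteq> 0" using assms(10) by (simp add: v_def)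
  have on_seg: "y + t *\<^sub>R v \<in> \<Omega>" "y + t *\<^sub>R v \<in> pre_extremal_set ?D ?f L l"
    if "0 < t" "t \<le> 1" for t
    using half_open_segment_points[OF that] assms(11) pre by (auto simp: v_def)
  have BL: "?B (y + t *\<^sub>R v) = ereal (L (y + t *\<^sub>R v))" if "0 < t" "t \<le> 1" for t
    using on_seg(2)[OF that] by (auto simp: pre_extremal_set_def contact_set_def)
  have LW: "L (y + t *\<^sub>R v) \<le> W (y + t *\<^sub>R v)" if t: "0 < t" "t \<le> 1" for t
    using assms(6)[of "y + t *\<^sub>R v"] BL[OF t] on_seg(1)[OF t] closure_subset by force
  have WB: "ereal (W z) \<le> ?B z" if z: "z \<in> frontier \<Omega>" for z
    using min_loc_concave_ge[of z ?D ?f] z assms(8)[OF z]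
    by (simp add: boundary_extension_def frontier_def)
  have yD: "y \<in> ?D" using assms(9) by (simp add: frontier_def)
  have seg: "closed_segment y (y + v) \<subseteq> ?D"
  proof
    fix z assume "z \<in> closed_segment y (y + v)"
    then obtain t where t: "0 \<le> t" "t \<le> 1" "z = y + t *\<^sub>R v"
      by (auto simp: closed_segment_def algebra_simps)
    then show "z \<in> ?D" using yD on_seg(1)[of t] closure_subset by (cases "t = 0") auto
  qed
  obtain V g where V: "open V" "?D \<subseteq> V" "C1_on V g" and g: "\<And>z. z \<in> ?D \<Longrightarrow> g z = W z"
    using assms(7) by (auto simp: C1_up_to_boundary_def)
  obtain G where G: "GDERIV g y :> G" using V yD by (auto simp: C1_on_def)
  obtain M where M: "\<And>z. GDERIV L z :> M" using affine_functional_GDERIV[OF L] by blast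
  define H where "H = G - M"
  have H: "GDERIV (\<lambda>z. g z - L z) y :> H" unfolding H_def by (rule GDERIV_diff[OF G M])
  have Wy: "W y = L y"
  proof (rule antisym)
    have "ereal ((1 - 1/2) * W y + (1/2) * L (y + v)) \<le> ?B ((1 - 1/2) *\<^sub>R y + (1/2) *\<^sub>R (y + v))"
      using WB[OF assms(9)] BL[of 1]
      by (intro locally_concave_onD[OF locally_concave_min_loc_concave seg]) auto
    also have "(1 - 1/2) *\<^sub>R y + (1/2) *\<^sub>R (y + v) = y + (1/2) *\<^sub>R v"
      by (simp add: algebra_simps flip: scaleR_left_distrib)
    also have "?B \<dots> = ereal (L (y + (1/2) *\<^sub>R v))" by (rule BL) auto
    also have "y + (1/2) *\<^sub>R v = (1 - 1/2) *\<^sub>R y + (1/2) *\<^sub>R (y + v)"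
      by (simp add: algebra_simps flip: scaleR_left_distrib)
    finally have "ereal ((1 - 1/2) * W y + (1/2) * L (y + v))
        \<le> ereal ((1 - 1/2) * L y + (1/2) * L (y + v))"
      unfolding affine_functional_combine[OF L] .
    then show "W y \<le> L y" by simp
  next
    have "isCont (\<lambda>z. g z - L z) y"
      using H has_derivative_continuous unfolding gderiv_def by blast
    moreover have "((\<lambda>t. y + t *\<^sub>R v) \<longlongrightarrow> y + 0 *\<^sub>R v) (at_right (0::real))"
      by (intro tendsto_intros)
    then have "((\<lambda>t. y + t *\<^sub>R v) \<longlongrightarrow> y) (at_right (0::real))" by simp
    ultimately have "((\<lambda>t. g (y + t *\<^sub>R v) - L (y + t *\<^sub>R v)) \<longlongrightarrow> g y - L y) (at_right (0::real))"
      by (rule isCont_tendsto_compose)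
    moreover have "eventually (\<lambda>t. 0 \<le> g (y + t *\<^sub>R v) - L (y + t *\<^sub>R v)) (at_right (0::real))"
      using eventually_at_right_real[of 0 "1::real", OF zero_less_one]
    proof eventually_elim
      case (elim t)
      then have "y + t *\<^sub>R v \<in> ?D" using on_seg(1)[of t] closure_subset by auto
      then show ?case using LW[of t] g elim by simp
    qed
    ultimately have "0 \<le> g y - L y"
      by (intro tendsto_lowerbound) auto
    then show "L y \<le> W y" using g yD by simp
  qed
  have c: "0 < inner H v"
    by (rule directional_derivative_pos_of_strictly_concave[OF assms(5) seg v0 L Wy LW H g])
  \<comment> \<open>At \<open>p = y + a (v + w)\<close> the linear part of \<open>W - L\<close> is at least \<open>a (H \<bullet> v) / 2\<close> by the choice of \<open>\<eta>\<close>,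
      and the remainder at most \<open>a (H \<bullet> v) / 4\<close> by the choice of \<open>e\<close>.\<close>
  define e where "e = inner H v / 4 / (norm v + 1)"
  have v1: "0 < norm v + 1" by (simp add: add_nonneg_pos)
  have e: "0 < e" using c v1 by (simp add: e_def)
  have e4: "e * (norm v + 1) = inner H v / 4"
    unfolding e_def using v1 by (metis less_irrefl nonzero_eq_divide_eq)
  obtain d where d: "0 < d" "\<And>z. norm (z - y) < d \<Longrightarrow>
      \<bar>(g z - L z) - (g y - L y) - inner H (z - y)\<bar> \<le> e * norm (z - y)"
    using GDERIV_linear_approx[OF H e] by blast
  define \<eta> where "\<eta> = Min {1, d / (norm v + 1), inner H v / (2 * (norm H + 1))}"
  have H1: "0 < norm H + 1" by (simp add: add_nonneg_pos)
  have "\<eta> \<le> d / (norm v + 1)" "\<eta> \<le> inner H v / (2 * (norm H + 1))" by (auto simp: \<eta>_def)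
  then have \<eta>: "0 < \<eta>" "\<eta> \<le> 1" "\<eta> * (norm v + 1) \<le> d" "\<eta> * (norm H + 1) \<le> inner H v / 2"
    using v1 H1 d(1) c by (auto simp: \<eta>_def field_simps)
  obtain r a w where r: "0 < r" "r \<le> 1" and a: "0 < a" "a < \<eta>" and w: "norm w \<le> \<eta>"
    and p: "y + a *\<^sub>R (v + w) \<in> frontier \<Omega>"
    and vis: "closed_segment (y + r *\<^sub>R v) (y + a *\<^sub>R (v + w)) \<subseteq> ?D"
    using visible_boundary_points_along_tangent[OF assms(1-3,9) _ on_seg(1) \<eta>(1)] assms(12)
    unfolding v_def by blast
  let ?p = "y + a *\<^sub>R (v + w)"
  obtain K where K: "y + r *\<^sub>R v \<in> interior K" "\<And>z. z \<in> K \<Longrightarrow> ?B z \<le> ereal (L z)"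
    using on_seg(2)[OF r] by (auto simp: pre_extremal_set_def)
  have "?B ?p \<le> ereal (L ?p)"
    by (rule affine_majorant_near_contact_point_extends[OF locally_concave_min_loc_concave vis L BL[OF r] K])
  then have "ereal (W ?p) \<le> ereal (L ?p)" using WB[OF p] by (rule order_trans[rotated])
  then have "W ?p \<le> L ?p" by simp
  have nw: "norm (v + w) \<le> norm v + 1"
    using norm_triangle_ineq[of v w] w \<eta>(2) by linarith
  have "norm (?p - y) = a * norm (v + w)" using a by simp
  then have np: "norm (?p - y) \<le> a * (norm v + 1)" using nw a by simp
  also have "\<dots> < \<eta> * (norm v + 1)" using a v1 by simp
  finally have "norm (?p - y) < d" using \<eta>(3) by simp
  from d(2)[OF this] have "inner H (?p - y) - e * norm (?p - y) \<le> W ?p - L ?p"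
    using g[of ?p] p g[OF yD] Wy by (simp add: frontier_def)
  moreover have "e * norm (?p - y) \<le> a * (inner H v / 4)"
    using mult_left_mono[OF np, of e] e e4 by (simp add: mult.left_commute)
  moreover have "a * (inner H v / 2) \<le> inner H (?p - y)"
  proof -
    have "\<bar>inner H w\<bar> \<le> norm H * norm w" by (rule Cauchy_Schwarz_ineq2)
    also have "\<dots> \<le> norm H * \<eta>" using w by (simp add: mult_left_mono)
    also have "\<dots> \<le> \<eta> * (norm H + 1)" using \<eta>(1) by (simp add: algebra_simps)
    also have "\<dots> \<le> inner H v / 2" by (rule \<eta>(4))
    finally have "inner H v / 2 \<le> inner H (v + w)" by (simp add: inner_add_right)
    then show ?thesis using a by simp
  qed
  moreover have "0 < a * (inner H v / 4)" using a c by simp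
  ultimately show False using \<open>W ?p \<le> L ?p\<close> by linarith
qed

end
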